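(* Let $(B_n)_{n\ge 0}$ be the sequence of rational numbers defined by $B_0=1$ and $\sum_{k=0}^{n}\binom{n}{k}B_k=B_n$ for all integers $n>1$. Then for all integers $m,n>0$, $$(-1)^{m}\sum_{k=0}^{m}\binom{m}{k}B_{n+k}=(-1)^{n}\sum_{k=0}^{n}\binom{n}{k}B_{m+k}.$$
   Context: The numbers $B_n$ are the Bernoulli numbers (with the convention $B_1=-\tfrac12$, as follows from the defining relation for $n=2$). *)

theory Defs
  imports Complex_Main
begin

text \<open>
  The recurrence at index \<open>n + 2\<close> has \<open>B (n + 2)\<close> on both sides and so determines
  \<open>B (n + 1)\<close>: exactly one sequence satisfies the defining conditions. It has
  \<open>B 1 = - 1 / 2\<close>.
\<close>

fun bernoulli_rec :: "nat \<Rightarrow> rat" where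
  "bernoulli_rec 0 = 1"
| "bernoulli_rec (Suc n) =
     - (\<Sum>k\<le>n. of_nat (Suc (Suc n) choose k) * bernoulli_rec k) / of_nat (Suc (Suc n))"

lemma bernoulli_recurrence_iff:
  fixes B :: "nat \<Rightarrow> rat"
  shows "(\<Sum>k=0..Suc (Suc n). of_nat (Suc (Suc n) choose k) * B k) = B (Suc (Suc n)) \<longleftrightarrow>
    B (Suc n) = - (\<Sum>k\<le>n. of_nat (Suc (Suc n) choose k) * B k) / of_nat (Suc (Suc n))"
proof -
  define S where "S = (\<Sum>k\<le>n. of_nat (Suc (Suc n) choose k) * B k)"
  define c where "c = (of_nat (Suc (Suc n)) :: rat)"
  have c: "c \<noteq> 0" unfolding c_def using of_nat_neq_0 by blast
  have "Suc (Suc n) choose Suc n = Suc (Suc n)"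
    using binomial_Suc_n by blast
  then have "(\<Sum>k=0..Suc (Suc n). of_nat (Suc (Suc n) choose k) * B k) =
      S + c * B (Suc n) + B (Suc (Suc n))"
    unfolding S_def c_def atLeast0AtMost sum.atMost_Suc by simp
  then show ?thesis
    using c unfolding S_def[symmetric] c_def[symmetric]
    by (auto simp: field_simps add_eq_0_iff)
qed

lemma bernoulli_sequence_ex1:
  "\<exists>!B :: nat \<Rightarrow> rat. B 0 = 1 \<and>
     (\<forall>n>1. (\<Sum>k=0..n. of_nat (n choose k) * B k) = B n)"
proof (rule ex1I[of _ bernoulli_rec])
  have "(\<Sum>k=0..n. of_nat (n choose k) * bernoulli_rec k) = bernoulli_rec n" if "n > 1" for n
  proof -
    from that obtain j where n: "n = Suc (Suc j)"
      by (metis less_imp_Suc_add One_nat_def add_Suc)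
    show ?thesis unfolding n bernoulli_recurrence_iff by (rule bernoulli_rec.simps(2))
  qed
  then show "bernoulli_rec 0 = 1 \<and>
      (\<forall>n>1. (\<Sum>k=0..n. of_nat (n choose k) * bernoulli_rec k) = bernoulli_rec n)"
    by simp
next
  fix B :: "nat \<Rightarrow> rat"
  assume B: "B 0 = 1 \<and> (\<forall>n>1. (\<Sum>k=0..n. of_nat (n choose k) * B k) = B n)"
  have "B n = bernoulli_rec n" for n
  proof (induction n rule: less_induct)
    case (less n)
    show ?case
    proof (cases n)
      case 0
      then show ?thesis using B by simp
    next
      case (Suc j)
      have "B (Suc j) = - (\<Sum>k\<le>j. of_nat (Suc (Suc j) choose k) * B k) / of_nat (Suc (Suc j))"
        using B[THEN conjunct2, rule_format, of "Suc (Suc j)"]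
        unfolding bernoulli_recurrence_iff by simp
      moreover have "(\<Sum>k\<le>j. of_nat (Suc (Suc j) choose k) * B k) =
          (\<Sum>k\<le>j. of_nat (Suc (Suc j) choose k) * bernoulli_rec k)"
        using less Suc by (intro sum.cong) auto
      ultimately show ?thesis using Suc by simp
    qed
  qed
  then show "B = bernoulli_rec" by blast
qed

end

(* Let L be the linear functional on polynomials with L(x^k) = B k. The claim says that
     G m n = (-1)^m L(x^n (1+x)^m) - (-1)^n L(x^m (1+x)^n)
   vanishes. Multiplying by (1+x) = 1 + x gives G m (n+1) = - G (m+1) n - G m n, so (-1)^n G m n is the
   n-th binomial sum of the boundary values g k = G k 0. The recurrence of B makes g vanish
   at even arguments. Since G is antisymmetric, G m m = 0; there g (2m) = 0, and by induction
   only the term m g (2m-1) survives. Hence g also vanishes at odd arguments. *)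

theory Submission
  imports Defs
begin

definition binomial_sum :: "(nat \<Rightarrow> 'a::comm_ring_1) \<Rightarrow> nat \<Rightarrow> nat \<Rightarrow> 'a" where
  "binomial_sum a m n = (\<Sum>k\<le>m. of_nat (m choose k) * a (n + k))"

lemma binomial_sum_0 [simp]: "binomial_sum a 0 n = a n"
  by (simp add: binomial_sum_def)

text \<open>Pascal's rule; in terms of L this is multiplication of x^n (1+x)^m by 1 + x.\<close>

lemma binomial_sum_Suc:
  "binomial_sum a (Suc m) n = binomial_sum a m n + binomial_sum a m (Suc n)"
proof -
  have "binomial_sum a (Suc m) n =
      a n + (\<Sum>k\<le>m. of_nat (Suc m choose Suc k) * a (n + Suc k))"
    unfolding binomial_sum_def by (subst sum.atMost_Suc_shift) simp
  also have "\<dots> = a n + (\<Sum>k\<le>m. of_nat (m choose Suc k) * a (n + Suc k))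
      + binomial_sum a m (Suc n)"
    by (simp add: binomial_sum_def sum.distrib algebra_simps)
  also have "a n + (\<Sum>k\<le>m. of_nat (m choose Suc k) * a (n + Suc k)) =
      (\<Sum>k\<le>Suc m. of_nat (m choose k) * a (n + k))"
    by (subst sum.atMost_Suc_shift) simp
  also have "\<dots> = binomial_sum a m n"
    by (simp add: binomial_sum_def binomial_eq_0)
  finally show ?thesis .
qed

text \<open>Each row comes from the previous one, so row \<open>H 0\<close> fixes the array.\<close>

lemma binomial_sum_unique:
  assumes "\<And>m n. H (Suc m) n = H m n + H m (Suc n)"
  shows "H m n = binomial_sum (H 0) m n"
  by (induction m arbitrary: n) (simp_all add: assms binomial_sum_Suc)

definition reciprocity_defect :: "(nat \<Rightarrow> 'a::comm_ring_1) \<Rightarrow> nat \<Rightarrow> nat \<Rightarrow> 'a" where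
  "reciprocity_defect a m n = (-1) ^ m * binomial_sum a m n - (-1) ^ n * binomial_sum a n m"

lemma reciprocity_defect_eq_binomial_sum:
  "(-1) ^ n * reciprocity_defect a m n = binomial_sum (\<lambda>k. reciprocity_defect a k 0) n m"
proof -
  \<comment> \<open>The sign turns the defect's recurrence into Pascal form; \<open>n\<close> comes
    first because the recursion runs over it.\<close>
  define H where "H = (\<lambda>n m. (-1) ^ n * reciprocity_defect a m n)"
  have "H (Suc n) m = H n m + H n (Suc m)" for n m
    by (simp add: H_def reciprocity_defect_def binomial_sum_Suc algebra_simps)
  from binomial_sum_unique[of H, OF this, of n m] show ?thesis
    by (simp add: H_def)
qed

lemma boundary_eq_0:
  fixes g :: "nat \<Rightarrow> 'a::{comm_ring_1,ring_char_0,semiring_no_zero_divisors}"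
  assumes even: "\<And>n. even n \<Longrightarrow> g n = 0"
    and diag: "\<And>m. binomial_sum g m m = 0"
  shows "g n = 0"
proof (induction n rule: less_induct)
  case (less n)
  show ?case
  proof (cases "even n")
    case False
    then obtain j where n: "n = Suc (2 * j)"
      by (metis oddE Suc_eq_plus1)
    \<comment> \<open>The diagonal sum at \<open>Suc j\<close> uses the indices \<open>j + 1\<close>
      to \<open>2 * j + 2\<close>: those below \<open>n\<close> vanish by induction, the last is
      even, and only \<open>n\<close> remains.\<close>
    have "g (Suc j + k) = 0" if "k < j" for k
      using less n that by simp
    moreover have "g (Suc j + Suc j) = 0"
      by (rule even) simp
    ultimately have "binomial_sum g (Suc j) (Suc j) = of_nat (Suc j choose j) * g (Suc j + j)"
      unfolding binomial_sum_def sum.atMost_Suc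
      by (simp flip: lessThan_Suc_atMost)
    moreover have "Suc j + j = n" "Suc j choose j = Suc j"
      using n by simp_all
    ultimately have "of_nat (Suc j) * g n = 0"
      using diag[of "Suc j"] by metis
    then show ?thesis
      using of_nat_neq_0 by (metis mult_eq_0_iff)
  qed (rule even)
qed

theorem mainTheorem1:
  fixes B :: "nat \<Rightarrow> rat" and m n :: nat
  assumes B_0: "B 0 = 1"
    and B_rec: "\<And>n. n > 1 \<Longrightarrow> (\<Sum>k=0..n. of_nat (n choose k) * B k) = B n"
    and "m > 0" and "n > 0"
  shows "(-1) ^ m * (\<Sum>k=0..m. of_nat (m choose k) * B (n + k)) =
         (-1) ^ n * (\<Sum>k=0..n. of_nat (n choose k) * B (m + k))"
proof -
  define g where "g = (\<lambda>k. reciprocity_defect B k 0)"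
  have even: "g k = 0" if "even k" for k
  proof (cases "k = 0")
    case False
    \<comment> \<open>Parity rules out \<open>k = 1\<close>, which \<open>B_rec\<close> does not
      cover, and makes the sign 1.\<close>
    with that have "k > 1" by presburger
    then show ?thesis
      using B_rec[of k] that
      by (simp add: g_def reciprocity_defect_def binomial_sum_def[of B k] atLeast0AtMost)
  qed (simp add: g_def reciprocity_defect_def)
  \<comment> \<open>Up to sign this is the defect at \<open>(k, k)\<close>, zero by
    antisymmetry.\<close>
  have "binomial_sum g k k = 0" for k
    unfolding g_def reciprocity_defect_eq_binomial_sum[symmetric]
    by (simp add: reciprocity_defect_def)
  with even have "g k = 0" for k
    by (rule boundary_eq_0)
  then have "(-1) ^ n * reciprocity_defect B m n = 0"
    unfolding reciprocity_defect_eq_binomial_sum g_def[symmetric]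
    by (simp add: binomial_sum_def)
  then show ?thesis
    by (simp add: reciprocity_defect_def binomial_sum_def atLeast0AtMost)
qed

end
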